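(* Let $w_{\min}\le w_{\max}$, $c_{\min}\le c_{\max}$ and $v_{\min}$ be real numbers. Then the following four subsets of $\mathbb{R}^3$ (with $\mathbf U=(\rho,y,z)^\top$) are all convex: $$\Omega_0=\{\mathbf U:\rho>0,\ z>0\},$$ $$\Omega_1=\{\mathbf U:\rho>0,\ w(\mathbf U)\in[w_{\min},w_{\max}],\ c(\mathbf U)\in[c_{\min},c_{\max}]\},$$ $$\Omega_2=\{\mathbf U:\rho>0,\ z>0,\ v(\mathbf U)\ge v_{\min}\},$$ $$\Omega=\Omega_1\cap\Omega_2 .$$
   Context: Fix parameters $\gamma\ge 0$, $\kappa\ge\gamma+1$, $v_{\rm ref}>0$. For $\rho>0$, $z>0$ the pressure is $p(\rho,z)=\frac{v_{\rm ref}}{\gamma}z^{\kappa}\rho^{\gamma-\kappa}$ if $\gamma>0$, and $p(\rho,z)=v_{\rm ref}\log\rho$ if $\gamma=0$. For $\mathbf U=(\rho,y,z)^\top$ with $\rho>0$: $w(\mathbf U)=y/\rho$, $c(\mathbf U)=z/\rho$, and (when also $z>0$) $v(\mathbf U)=w(\mathbf U)-p(\rho,z)$. *)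

theory Defs
  imports "HOL-Analysis.Analysis"
begin

text \<open>A state \<open>U = (\<rho>, y, z)\<close> is a vector of type \<^typ>\<open>real ^ 3\<close> with
  \<open>\<rho> = U $ 1\<close>, \<open>y = U $ 2\<close>, \<open>z = U $ 3\<close>.\<close>

text \<open>Meaningful for \<open>\<rho> > 0\<close> and \<open>z > 0\<close> only.\<close>
definition pressure :: "real \<Rightarrow> real \<Rightarrow> real \<Rightarrow> real \<Rightarrow> real \<Rightarrow> real" where
  "pressure \<gamma> \<kappa> vref \<rho> z =
     (if \<gamma> = 0 then vref * ln \<rho> else vref / \<gamma> * z powr \<kappa> * \<rho> powr (\<gamma> - \<kappa>))"

definition w_of :: "real ^ 3 \<Rightarrow> real" where
  "w_of U = U $ 2 / U $ 1"

definition c_of :: "real ^ 3 \<Rightarrow> real" where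
  "c_of U = U $ 3 / U $ 1"

definition v_of :: "real \<Rightarrow> real \<Rightarrow> real \<Rightarrow> real ^ 3 \<Rightarrow> real" where
  "v_of \<gamma> \<kappa> vref U = w_of U - pressure \<gamma> \<kappa> vref (U $ 1) (U $ 3)"

definition Omega0 :: "(real ^ 3) set" where
  "Omega0 = {U. U $ 1 > 0 \<and> U $ 3 > 0}"

definition Omega1 :: "real \<Rightarrow> real \<Rightarrow> real \<Rightarrow> real \<Rightarrow> (real ^ 3) set" where
  "Omega1 wmin wmax cmin cmax =
     {U. U $ 1 > 0 \<and> w_of U \<in> {wmin..wmax} \<and> c_of U \<in> {cmin..cmax}}"

definition Omega2 :: "real \<Rightarrow> real \<Rightarrow> real \<Rightarrow> real \<Rightarrow> (real ^ 3) set" where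
  "Omega2 \<gamma> \<kappa> vref vmin =
     {U. U $ 1 > 0 \<and> U $ 3 > 0 \<and> v_of \<gamma> \<kappa> vref U \<ge> vmin}"

definition Omega :: "real \<Rightarrow> real \<Rightarrow> real \<Rightarrow> real \<Rightarrow> real \<Rightarrow> real \<Rightarrow> real \<Rightarrow> real \<Rightarrow> (real ^ 3) set" where
  "Omega \<gamma> \<kappa> vref wmin wmax cmin cmax vmin =
     Omega1 wmin wmax cmin cmax \<inter> Omega2 \<gamma> \<kappa> vref vmin"

end

theory Submission
  imports Defs
begin

text \<open>Multiplying by \<open>\<rho> > 0\<close> turns the bounds on \<open>w\<close> and \<open>c\<close> into linear inequalities, and
  \<open>v \<ge> vmin\<close> into \<open>y \<ge> vmin \<rho> + \<rho> p(\<rho>, z)\<close>. So everything rests on the convexity of \<open>\<rho> p(\<rho>, z)\<close>,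
  which is \<open>vref \<rho> ln \<rho>\<close> or a multiple of \<open>z powr a * \<rho> powr (- b)\<close> with \<open>b \<ge> 0\<close> and
  \<open>a \<ge> b + 1\<close>. Both functions lie above their tangent planes; for the second one this is the
  weighted AM-GM inequality, a consequence of \<open>ln u \<le> u - 1\<close>.\<close>

text \<open>This is \<open>ln x \<le> x - 1\<close> at \<open>x = u / s\<close>, multiplied by
  \<open>s\<close>. Solved for \<open>s * ln s\<close>, it is the tangent bound of that function at
  \<open>u\<close>.\<close>

lemma mult_one_plus_ln_div_le:
  fixes s u :: real
  assumes "s > 0" "u > 0"
  shows "s * (1 + ln u - ln s) \<le> u"
proof -
  have "ln (u / s) \<le> u / s - 1"
    using assms by (intro ln_le_minus_one) simp
  then have "s * (1 + ln u - ln s) \<le> s * (u / s)"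
    using assms by (intro mult_left_mono) (simp_all add: ln_div)
  then show ?thesis using assms by simp
qed

text \<open>Weighted AM-GM for the numbers \<open>s powr a * t powr (- b)\<close>, \<open>t\<close>
  and \<open>1\<close> with weights \<open>1\<close>, \<open>b\<close> and \<open>a - b - 1\<close>.
  The weights are nonnegative with sum \<open>a\<close>, and the weighted geometric mean is
  \<open>s\<close>.\<close>

lemma powr_mult_powr_minus_tangent_at_one:
  fixes a b s t :: real
  assumes "b \<ge> 0" "a \<ge> b + 1" "s > 0" "t > 0"
  shows "1 + a * (s - 1) - b * (t - 1) \<le> s powr a * t powr (- b)"
proof -
  let ?X = "s powr a * t powr (- b)"
  have X: "?X > 0" using assms by simp
  have lnX: "ln ?X = a * ln s - b * ln t"
    using assms by (simp add: ln_mult_pos ln_powr)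
  \<comment> \<open>One logarithmic bound per number, scaled by its weight. In the sum all
    logarithms cancel by \<open>lnX\<close>, leaving
    \<open>a * s \<le> ?X + b * t + (a - b - 1)\<close>.\<close>
  have "s * (1 + ln ?X - ln s) \<le> ?X"
    by (rule mult_one_plus_ln_div_le[OF \<open>s > 0\<close> X])
  moreover have "b * (s * (1 + ln t - ln s)) \<le> b * t"
    using assms by (intro mult_left_mono mult_one_plus_ln_div_le)
  moreover have "(a - b - 1) * (s * (1 + ln 1 - ln s)) \<le> (a - b - 1) * 1"
    using assms by (intro mult_left_mono mult_one_plus_ln_div_le) auto
  ultimately show ?thesis
    unfolding lnX by (simp add: algebra_simps)
qed

text \<open>Powers are multiplicative, so rescaling by \<open>s = z / z0\<close> and
  \<open>t = r / r0\<close> moves the point of tangency from \<open>(1, 1)\<close> to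
  \<open>(z0, r0)\<close>.\<close>

lemma powr_mult_powr_minus_tangent:
  fixes a b z r z0 r0 :: real
  assumes "b \<ge> 0" "a \<ge> b + 1" "z > 0" "r > 0" "z0 > 0" "r0 > 0"
  shows "z0 powr a * r0 powr (- b) * (1 + a * (z / z0 - 1) - b * (r / r0 - 1))
         \<le> z powr a * r powr (- b)"
proof -
  have "z0 powr a * r0 powr (- b) * (1 + a * (z / z0 - 1) - b * (r / r0 - 1))
        \<le> z0 powr a * r0 powr (- b) * ((z / z0) powr a * (r / r0) powr (- b))"
    using assms by (intro mult_left_mono powr_mult_powr_minus_tangent_at_one) auto
  also have "\<dots> = z powr a * r powr (- b)"
    using assms by (simp add: powr_divide)
  finally show ?thesis .
qed

text \<open>Convexity needs only some affine minorant touching at \<open>(r0, z0)\<close>; hiding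
  its slopes \<open>A\<close> and \<open>B\<close> lets both pressure laws be treated alike
  afterwards.\<close>

lemma density_mult_pressure_subgradient:
  fixes \<gamma> \<kappa> vref r0 z0 :: real
  assumes "\<gamma> \<ge> 0" "\<kappa> \<ge> \<gamma> + 1" "vref > 0" "r0 > 0" "z0 > 0"
  obtains A B where "\<And>r z. r > 0 \<Longrightarrow> z > 0 \<Longrightarrow>
    r0 * pressure \<gamma> \<kappa> vref r0 z0 + A * (r - r0) + B * (z - z0) \<le> r * pressure \<gamma> \<kappa> vref r z"
proof (cases "\<gamma> = 0")
  case True
  \<comment> \<open>The slope in \<open>r\<close> is the derivative of
    \<open>vref * r * ln r\<close> at \<open>r0\<close>; nothing depends on
    \<open>z\<close>.\<close>
  have "r0 * pressure \<gamma> \<kappa> vref r0 z0 + vref * (1 + ln r0) * (r - r0) + 0 * (z - z0)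
        \<le> r * pressure \<gamma> \<kappa> vref r z" if "r > 0" for r z
  proof -
    have "vref * (r * (1 + ln r0 - ln r)) \<le> vref * r0"
      using assms that by (intro mult_left_mono mult_one_plus_ln_div_le) auto
    then show ?thesis
      using True by (simp add: pressure_def algebra_simps)
  qed
  then show ?thesis using that by blast
next
  case False
  \<comment> \<open>The factor \<open>r\<close> raises the exponent
    \<open>\<gamma> - \<kappa>\<close> by one, to \<open>- b\<close>. Here \<open>b \<ge> 0\<close>
    is \<open>\<kappa> \<ge> \<gamma> + 1\<close>, and \<open>\<kappa> \<ge> b + 1\<close> is
    \<open>\<gamma> \<ge> 0\<close>.\<close>
  define b where "b = \<kappa> - \<gamma> - 1"
  define C where "C = vref / \<gamma>"
  define F where "F = z0 powr \<kappa> * r0 powr (- b)"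
  have "C \<ge> 0" "b \<ge> 0" "\<kappa> \<ge> b + 1"
    using assms by (auto simp: C_def b_def)
  have p: "r * pressure \<gamma> \<kappa> vref r z = C * (z powr \<kappa> * r powr (- b))" if "r > 0" for r z
  proof -
    have "r powr (- b) = r powr (1 + (\<gamma> - \<kappa>))" by (simp add: b_def algebra_simps)
    also have "\<dots> = r * r powr (\<gamma> - \<kappa>)" using that by (simp add: powr_add)
    finally show ?thesis using False by (simp add: pressure_def C_def)
  qed
  \<comment> \<open>The slopes are the partial derivatives of
    \<open>C * z powr \<kappa> * r powr (- b)\<close> at \<open>(r0, z0)\<close>.\<close>
  have "r0 * pressure \<gamma> \<kappa> vref r0 z0 + (- (C * F * b / r0)) * (r - r0) + C * F * \<kappa> / z0 * (z - z0)
        \<le> r * pressure \<gamma> \<kappa> vref r z" if "r > 0" "z > 0" for r z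
  proof -
    have "C * (F * (1 + \<kappa> * (z / z0 - 1) - b * (r / r0 - 1))) \<le> C * (z powr \<kappa> * r powr (- b))"
      unfolding F_def
      using \<open>C \<ge> 0\<close> \<open>b \<ge> 0\<close> \<open>\<kappa> \<ge> b + 1\<close> assms that
      by (intro mult_left_mono powr_mult_powr_minus_tangent) auto
    moreover have "C * (F * (1 + \<kappa> * (z / z0 - 1) - b * (r / r0 - 1)))
        = C * F + (- (C * F * b / r0)) * (r - r0) + C * F * \<kappa> / z0 * (z - z0)"
      using assms by (simp add: field_simps)
    ultimately show ?thesis
      using p[OF \<open>r0 > 0\<close>, of z0] p[OF \<open>r > 0\<close>, of z] by (simp add: F_def)
  qed
  then show ?thesis using that by blast
qed

lemma convex_combination_pos:
  fixes a b u v :: real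
  assumes "a > 0" "b > 0" "u \<ge> 0" "v \<ge> 0" "u + v = 1"
  shows "u * a + v * b > 0"
  using convexD[of "{0::real<..}" a b u v] assms by simp

lemma density_mult_pressure_convex:
  fixes \<gamma> \<kappa> vref r1 r2 z1 z2 u v :: real
  assumes "\<gamma> \<ge> 0" "\<kappa> \<ge> \<gamma> + 1" "vref > 0"
    and pos: "r1 > 0" "r2 > 0" "z1 > 0" "z2 > 0" and uv: "u \<ge> 0" "v \<ge> 0" "u + v = 1"
  shows "(u * r1 + v * r2) * pressure \<gamma> \<kappa> vref (u * r1 + v * r2) (u * z1 + v * z2)
         \<le> u * (r1 * pressure \<gamma> \<kappa> vref r1 z1) + v * (r2 * pressure \<gamma> \<kappa> vref r2 z2)"
proof -
  define r0 z0 where "r0 = u * r1 + v * r2" and "z0 = u * z1 + v * z2"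
  have "r0 > 0" "z0 > 0"
    unfolding r0_def z0_def using pos uv by (simp_all add: convex_combination_pos)
  with assms(1-3) obtain A B where AB: "\<And>r z. r > 0 \<Longrightarrow> z > 0 \<Longrightarrow>
      r0 * pressure \<gamma> \<kappa> vref r0 z0 + A * (r - r0) + B * (z - z0) \<le> r * pressure \<gamma> \<kappa> vref r z"
    using density_mult_pressure_subgradient by blast
  let ?P = "r0 * pressure \<gamma> \<kappa> vref r0 z0"
  have "u * (?P + A * (r1 - r0) + B * (z1 - z0)) + v * (?P + A * (r2 - r0) + B * (z2 - z0))
      \<le> u * (r1 * pressure \<gamma> \<kappa> vref r1 z1) + v * (r2 * pressure \<gamma> \<kappa> vref r2 z2)"
    using pos uv by (intro add_mono mult_left_mono AB)
  \<comment> \<open>Since \<open>u + v = 1\<close>, averaging the affine minorant over both points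
    returns its value \<open>?P\<close> at the combination \<open>(r0, z0)\<close>.\<close>
  moreover have "u * (?P + A * (r1 - r0) + B * (z1 - z0)) + v * (?P + A * (r2 - r0) + B * (z2 - z0))
      = (u + v) * (?P - A * r0 - B * z0) + A * r0 + B * z0"
    unfolding r0_def z0_def by (simp add: algebra_simps)
  ultimately show ?thesis
    using uv by (simp add: r0_def z0_def)
qed

lemma convex_Omega0: "convex Omega0"
  by (rule convexI) (simp add: Omega0_def convex_combination_pos)

lemma convex_Omega1: "convex (Omega1 wmin wmax cmin cmax)"
proof -
  have eq: "Omega1 wmin wmax cmin cmax = {U. U $ 1 > 0 \<and> wmin * U $ 1 \<le> U $ 2 \<and> U $ 2 \<le> wmax * U $ 1
      \<and> cmin * U $ 1 \<le> U $ 3 \<and> U $ 3 \<le> cmax * U $ 1}"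
    by (auto simp: Omega1_def w_of_def c_of_def field_simps)
  \<comment> \<open>\<open>comb\<close> carries the lower bounds to a convex combination,
    \<open>comb'\<close> the upper ones.\<close>
  have comb: "m * (u * a + v * b) \<le> u * c + v * d"
    if "m * a \<le> c" "m * b \<le> d" "u \<ge> 0" "v \<ge> 0" for m a b c d u v :: real
    using add_mono[OF mult_left_mono[OF that(1,3)] mult_left_mono[OF that(2,4)]]
    by (simp add: algebra_simps)
  have comb': "u * c + v * d \<le> m * (u * a + v * b)"
    if "c \<le> m * a" "d \<le> m * b" "u \<ge> 0" "v \<ge> 0" for m a b c d u v :: real
    using add_mono[OF mult_left_mono[OF that(1,3)] mult_left_mono[OF that(2,4)]]
    by (simp add: algebra_simps)
  show ?thesis
    unfolding eq by (rule convexI) (simp add: convex_combination_pos comb comb')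
qed

text \<open>In the coordinate \<open>y\<close> the set is the epigraph of
  \<open>vmin * \<rho> + \<rho> * p(\<rho>, z)\<close> over the open quadrant, a linear function
  plus a convex one.\<close>

lemma convex_Omega2:
  assumes "\<gamma> \<ge> 0" "\<kappa> \<ge> \<gamma> + 1" "vref > 0"
  shows "convex (Omega2 \<gamma> \<kappa> vref vmin)"
proof -
  have eq: "Omega2 \<gamma> \<kappa> vref vmin = {U. U $ 1 > 0 \<and> U $ 3 > 0
      \<and> vmin * U $ 1 + U $ 1 * pressure \<gamma> \<kappa> vref (U $ 1) (U $ 3) \<le> U $ 2}"
    by (auto simp: Omega2_def v_of_def w_of_def field_simps)
  show ?thesis
    unfolding eq
  proof (rule convexI, clarsimp simp: convex_combination_pos)
    fix U V :: "real ^ 3" and u v :: real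
    let ?p = "pressure \<gamma> \<kappa> vref"
    assume pos: "U $ 1 > 0" "U $ 3 > 0" "V $ 1 > 0" "V $ 3 > 0"
      and uv: "0 \<le> u" "0 \<le> v" "u + v = 1"
      and U: "vmin * U $ 1 + U $ 1 * ?p (U $ 1) (U $ 3) \<le> U $ 2"
      and V: "vmin * V $ 1 + V $ 1 * ?p (V $ 1) (V $ 3) \<le> V $ 2"
    have "(u * U $ 1 + v * V $ 1) * ?p (u * U $ 1 + v * V $ 1) (u * U $ 3 + v * V $ 3)
        \<le> u * (U $ 1 * ?p (U $ 1) (U $ 3)) + v * (V $ 1 * ?p (V $ 1) (V $ 3))"
      by (rule density_mult_pressure_convex) (use assms pos uv in auto)
    moreover have "u * (vmin * U $ 1 + U $ 1 * ?p (U $ 1) (U $ 3))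
        + v * (vmin * V $ 1 + V $ 1 * ?p (V $ 1) (V $ 3)) \<le> u * U $ 2 + v * V $ 2"
      using U V uv by (intro add_mono mult_left_mono)
    moreover have "vmin * (u * U $ 1 + v * V $ 1) = u * (vmin * U $ 1) + v * (vmin * V $ 1)"
      by (simp add: algebra_simps)
    ultimately show "vmin * (u * U $ 1 + v * V $ 1)
        + (u * U $ 1 + v * V $ 1) * ?p (u * U $ 1 + v * V $ 1) (u * U $ 3 + v * V $ 3)
        \<le> u * U $ 2 + v * V $ 2"
      unfolding distrib_left by linarith
  qed
qed

theorem lemma2p1:
  fixes \<gamma> \<kappa> vref wmin wmax cmin cmax vmin :: real
  assumes "\<gamma> \<ge> 0" and "\<kappa> \<ge> \<gamma> + 1" and "vref > 0"
    and "wmin \<le> wmax" and "cmin \<le> cmax"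
  shows "convex Omega0 \<and>
         convex (Omega1 wmin wmax cmin cmax) \<and>
         convex (Omega2 \<gamma> \<kappa> vref vmin) \<and>
         convex (Omega \<gamma> \<kappa> vref wmin wmax cmin cmax vmin)"
  using assms
  by (simp add: Omega_def convex_Int convex_Omega0 convex_Omega1 convex_Omega2)

end
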